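(* For $n\ge 1$ and $k\in\{1,\dots,2^{n-1}\}$, let $\mathbf{x}^{(n,k)}=\mathrm{decode}_n(2^{n-1}+k-1)\in\{0,1\}^n$ and define \[ v^n(k):=\operatorname{code}\big(\lambda(\mathbf{x}^{(n,k)})\big). \] Then: (i) $v^1(1)=0$; (ii) $v^2(1)=0$ and $v^2(2)=1$; (iii) for every $n\ge 3$ and every $k\in\{1,\dots,2^{n-1}\}$, \[ v^n(k)=2^{\binom{n-1}{2}}(k-1)+\sum_{j=1}^{n-2}2^{\binom{j}{2}}\big(S^{2^j}(k)-1\big), \] with the convention $\binom{1}{2}=0$.
   Context: For $\mathbf{x}=(x_1,\dots,x_n)\in\{0,1\}^n$, let $\lambda(\mathbf{x})\in\{0,1\}^{\binom n2}$ be the vector with coordinates $\lambda(\mathbf{x})_{ij}=\mathbf{1}(x_i=x_j)$ for $1\le i<j\le n$. The coordinates are listed in lexicographic order of the pairs: $(1,2),(1,3),\dots,(1,n),(2,3),\dots,(n-1,n)$. For $n=1$, $\lambda(\mathbf{x})$ is the empty vector. For a binary vector $\mathbf{y}=(y_1,\dots,y_m)$, define $\operatorname{code}(\mathbf{y})=\sum_{j=1}^m y_j2^{m-j}$, with the code of the empty vector equal to $0$. For $0\le a<2^n$, $\mathrm{decode}_n(a)$ is the unique $\mathbf{x}\in\{0,1\}^n$ with $\operatorname{code}(\mathbf{x})=a$; this is the $n$-bit binary representation of $a$, padded with leading zeros. Thus $\mathbf{x}^{(n,k)}$ ranges over the binary vectors of length $n$ with first coordinate $1$, in increasing numerical order.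 Alternating cycle function: for an integer $N\ge 2$ and a positive integer $k$, let $q=\lfloor (k-1)/N\rfloor$ and $r=k-qN\in\{1,\dots,N\}$. Set $S^N(k)=N+1-r$ if $q$ is even, and $S^N(k)=r$ if $q$ is odd. Background (known result, not part of the claim): the vectors $\lambda(\mathbf{x}^{(n,k)})$, $k=1,\dots,2^{n-1}$, are exactly the $2^{n-1}$ vertices of the polytope $\mathbf{1}-\operatorname{CUT}(n)=\{\mathbf{1}-\mathbf{z}:\mathbf{z}\in\operatorname{CUT}(n)\}$. Here $\operatorname{CUT}(n)$ is the convex hull of the cut vectors of the complete graph $K_n$. *)

theory Defs
  imports Complex_Main
begin

text \<open>
  Binary vectors are lists over \<open>{0, 1}\<close>. Lists are indexed from 0, so the coordinate
  written \<open>x\<^sub>i\<close> in 1-based notation is \<open>x ! (i - 1)\<close>.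
\<close>

definition binary_vectors :: "nat \<Rightarrow> nat list set" where
  "binary_vectors n = {x. length x = n \<and> set x \<subseteq> {0, 1}}"

text \<open>The comprehension enumerates the pairs \<open>i < j\<close> in lexicographic order.\<close>

definition agreement_vector :: "nat list \<Rightarrow> nat list" where
  "agreement_vector x =
     [if x ! i = x ! j then 1 else 0. i \<leftarrow> [0..<length x], j \<leftarrow> [Suc i..<length x]]"

definition code :: "nat list \<Rightarrow> nat" where
  "code y = (\<Sum>j = 1..length y. y ! (j - 1) * 2 ^ (length y - j))"

text \<open>Meaningful for \<open>a < 2 ^ n\<close>; see \<open>decode_unique\<close> below.\<close>

definition decode :: "nat \<Rightarrow> nat \<Rightarrow> nat list" where
  "decode n a = (THE x. x \<in> binary_vectors n \<and> code x = a)"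

lemma code_snoc: "code (xs @ [b]) = 2 * code xs + b"
proof -
  have "(\<Sum>j = 1..length xs. (xs @ [b]) ! (j - 1) * 2 ^ (Suc (length xs) - j))
      = (\<Sum>j = 1..length xs. 2 * (xs ! (j - 1) * 2 ^ (length xs - j)))"
    by (intro sum.cong) (auto simp: nth_append Suc_diff_le)
  then show ?thesis
    by (simp add: code_def sum_distrib_left)
qed

lemma decode_unique:
  assumes "a < 2 ^ n"
  shows "\<exists>!x. x \<in> binary_vectors n \<and> code x = a"
  using assms
proof (induction n arbitrary: a)
  case 0
  then show ?case by (auto simp: binary_vectors_def code_def)
next
  case (Suc n)
  from Suc.prems have "a div 2 < 2 ^ n" by auto
  from Suc.IH[OF this] obtain x where x: "x \<in> binary_vectors n" "code x = a div 2"
    and uniq: "\<And>y. y \<in> binary_vectors n \<Longrightarrow> code y = a div 2 \<Longrightarrow> y = x"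
    by auto
  show ?case
  proof (intro ex1I conjI)
    show "x @ [a mod 2] \<in> binary_vectors (Suc n)"
      using x by (auto simp: binary_vectors_def)
    show "code (x @ [a mod 2]) = a"
      using x by (simp add: code_snoc)
  next
    fix y assume y: "y \<in> binary_vectors (Suc n) \<and> code y = a"
    then obtain z b where yz: "y = z @ [b]"
      by (cases y rule: rev_cases) (auto simp: binary_vectors_def)
    with y have z: "z \<in> binary_vectors n" and b: "b = 0 \<or> b = 1" and "2 * code z + b = a"
      by (auto simp: binary_vectors_def code_snoc)
    then have "code z = a div 2" "b = a mod 2" by auto
    with uniq z yz show "y = x @ [a mod 2]" by simp
  qed
qed

definition x_vec :: "nat \<Rightarrow> nat \<Rightarrow> nat list" where
  "x_vec n k = decode n (2 ^ (n - 1) + k - 1)"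

definition v :: "nat \<Rightarrow> nat \<Rightarrow> nat" where
  "v n k = code (agreement_vector (x_vec n k))"

text \<open>
  Meaningful for \<open>N \<ge> 2\<close> and \<open>k \<ge> 1\<close>; then \<open>r \<in> {1..N}\<close> and none of the subtractions
  on natural numbers truncates.
\<close>

definition alt_cycle :: "nat \<Rightarrow> nat \<Rightarrow> nat" where
  "alt_cycle N k =
     (let q = (k - 1) div N; r = k - q * N
      in if even q then N + 1 - r else r)"

end

theory Submission
  imports Defs
begin

text \<open>
  Row \<open>i\<close> of the triangular array of agreements compares \<open>x\<^sub>i\<close> with the tail after it, so it
  equals the tail if \<open>x\<^sub>i = 1\<close> and its complement if \<open>x\<^sub>i = 0\<close>. The tail of length \<open>j = n - i\<close> has
  code \<open>(k - 1) mod 2\<^sup>j\<close>. Row 1 therefore contributes \<open>k - 1\<close>, as \<open>x\<^sub>1 = 1\<close>. For \<open>i \<ge> 2\<close> the bit \<open>x\<^sub>i\<close>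
  is the parity of \<open>(k - 1) div 2\<^sup>j\<close>, so the two cases are exactly the increasing and the decreasing
  runs of \<open>S\<close> for the period \<open>2\<^sup>j\<close>.
\<close>

lemma code_Nil [simp]: "code [] = 0"
  by (simp add: code_def)

lemma code_append: "code (xs @ ys) = code xs * 2 ^ length ys + code ys"
proof (induction ys rule: rev_induct)
  case (snoc y ys)
  have "code (xs @ ys @ [y]) = 2 * code (xs @ ys) + y"
    using code_snoc[of "xs @ ys" y] by simp
  then show ?case
    by (simp add: snoc code_snoc algebra_simps)
qed simp

lemma code_Cons: "code (b # xs) = b * 2 ^ length xs + code xs"
  using code_append[of "[b]" xs] by (simp add: code_def)

lemma code_less: "set xs \<subseteq> {0, 1} \<Longrightarrow> code xs < 2 ^ length xs"
  by (induction xs) (auto simp: code_Cons)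

text \<open>Each position holds exactly one 1 among the list and its complement, so the codes add up
  to a number with all bits 1. The form with \<open>+ 1\<close> avoids subtraction on
  naturals.\<close>

lemma code_complement:
  "set xs \<subseteq> {0, 1} \<Longrightarrow> code (map (\<lambda>c. if 0 = c then 1 else 0) xs) + code xs + 1 = 2 ^ length xs"
  by (induction xs) (auto simp: code_Cons)

lemma map_agree_one:
  assumes "set xs \<subseteq> {0, 1 :: nat}"
  shows "map (\<lambda>c. if 1 = c then 1 else 0) xs = xs"
  using assms by (intro map_idI) auto

lemma agreement_vector_Nil [simp]: "agreement_vector [] = []"
  by (simp add: agreement_vector_def)

text \<open>Lexicographic order puts the pairs containing the first index first; the others are the
  pairs of the tail, both indices shifted by one.\<close>

lemma agreement_vector_Cons:
  "agreement_vector (b # xs) = map (\<lambda>c. if b = c then 1 else 0) xs @ agreement_vector xs"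
proof -
  have indices: "[0..<Suc (length xs)] = 0 # map Suc [0..<length xs]"
    by (simp add: map_Suc_upt upt_conv_Cons del: upt_Suc)
  have row: "map f [Suc m..<Suc n] = map (\<lambda>j. f (Suc j)) [m..<n]" for f :: "nat \<Rightarrow> nat" and m n
    by (simp add: map_Suc_upt[symmetric] comp_def del: upt_Suc)
  have first: "map (\<lambda>j. if b = xs ! j then 1 else 0) [0..<length xs]
      = map (\<lambda>c. if b = c then 1 else 0) xs"
    by (rule nth_equalityI) auto
  show ?thesis
    by (simp add: agreement_vector_def indices row first comp_def del: upt_Suc)
qed

lemma length_agreement_vector: "length (agreement_vector xs) = length xs choose 2"
  by (induction xs) (simp_all add: agreement_vector_Cons numeral_2_eq_2)

lemma code_agreement_row:
  assumes "set (b # xs) \<subseteq> {0, 1}" "k \<ge> 1"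
    and "code (b # xs) = (k - 1) mod 2 ^ Suc (length xs)"
  shows "int (code (map (\<lambda>c. if b = c then 1 else 0) xs)) = int (alt_cycle (2 ^ length xs) k) - 1"
    and "code xs = (k - 1) mod 2 ^ length xs"
proof -
  define N q r :: nat where "N = 2 ^ length xs" and "q = (k - 1) div N" and "r = (k - 1) mod N"
  \<comment> \<open>Both sides are two-digit expansions in base \<open>N\<close>, so dividing by
    \<open>N\<close> identifies the leading digits.\<close>
  have eq: "b * N + code xs = (q mod 2) * N + r"
    using assms(3) mod_mult2_eq[of "k - 1" N 2]
    by (simp add: code_Cons N_def q_def r_def mult.commute)
  have less: "code xs < N" "r < N"
    using code_less[of xs] assms(1) by (auto simp: N_def r_def)
  have "b = (b * N + code xs) div N"
    using less by simp
  also have "\<dots> = q mod 2"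
    unfolding eq using less by simp
  finally have b: "b = q mod 2" .
  with eq have xs: "code xs = r"
    by simp
  from xs show "code xs = (k - 1) mod 2 ^ length xs"
    by (simp add: r_def N_def)
  have "k - 1 = q * N + r"
    by (simp add: q_def r_def)
  \<comment> \<open>The remainder inside \<open>alt_cycle\<close> is 1-based, hence one more than
    \<open>r\<close>.\<close>
  with \<open>k \<ge> 1\<close> have r: "k - q * N = Suc r"
    by linarith
  have bits: "set xs \<subseteq> {0, 1}"
    using assms(1) by simp
  have "code (map (\<lambda>c. if b = c then 1 else 0) xs) = (if even q then N - Suc r else r)"
    using code_complement[OF bits] map_agree_one[OF bits] xs b
    by (auto simp: N_def even_iff_mod_2_eq_zero odd_iff_mod_2_eq_one)
  then show "int (code (map (\<lambda>c. if b = c then 1 else 0) xs)) = int (alt_cycle (2 ^ length xs) k) - 1"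
    using r less unfolding alt_cycle_def Let_def N_def[symmetric] q_def[symmetric]
    by auto
qed

text \<open>The residue hypothesis passes to tails, which drives the induction. The row with a tail
  of length \<open>j\<close> is followed by \<open>j choose 2\<close> coordinates, whence its
  weight.\<close>

lemma code_agreement_vector:
  assumes "set xs \<subseteq> {0, 1}" "k \<ge> 1" "code xs = (k - 1) mod 2 ^ length xs"
  shows "int (code (agreement_vector xs))
    = (\<Sum>j<length xs. 2 ^ (j choose 2) * (int (alt_cycle (2 ^ j) k) - 1))"
  using assms
proof (induction xs)
  case (Cons b xs)
  note row = code_agreement_row[OF Cons.prems(1,2)]
  from Cons.prems(3) have "code (b # xs) = (k - 1) mod 2 ^ Suc (length xs)"
    by simp
  note row = row[OF this]
  show ?case
    using Cons.IH[OF _ Cons.prems(2) row(2)] Cons.prems(1) row(1)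
    by (simp add: agreement_vector_Cons code_append length_agreement_vector)
qed simp

lemma x_vec_eq_Cons:
  assumes "n \<ge> 1" "k \<in> {1..2 ^ (n - 1)}"
  obtains xs where "x_vec n k = 1 # xs" "length xs = n - 1" "set xs \<subseteq> {0, 1}" "code xs = k - 1"
proof -
  define a where "a = 2 ^ (n - 1) + k - 1"
  have "(2 :: nat) ^ n = 2 * 2 ^ (n - 1)"
    using assms(1) by (cases n) auto
  with assms(2) have "a < 2 ^ n"
    by (auto simp: a_def)
  from theI'[OF decode_unique[OF this]]
  have x: "x_vec n k \<in> binary_vectors n" "code (x_vec n k) = a"
    by (simp_all add: x_vec_def decode_def a_def)
  with assms(1) obtain b xs where bxs: "x_vec n k = b # xs"
    by (cases "x_vec n k") (auto simp: binary_vectors_def)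
  with x have xs: "length xs = n - 1" "set xs \<subseteq> {0, 1}" "b = 0 \<or> b = 1"
    and c: "b * 2 ^ (n - 1) + code xs = a"
    by (auto simp: binary_vectors_def code_Cons)
  \<comment> \<open>With this bound a leading 0 would make the code smaller than
    \<open>2 ^ (n - 1)\<close>, hence smaller than \<open>a\<close>.\<close>
  have "code xs < 2 ^ (n - 1)"
    using code_less xs by metis
  with c xs(3) assms(2) have "b = 1" "code xs = k - 1"
    by (auto simp: a_def)
  with bxs xs that show thesis
    by simp
qed

text \<open>The degenerate period 1 belongs to the empty row of the last coordinate; this makes the
  term \<open>j = 0\<close> vanish.\<close>

lemma alt_cycle_one: "k \<ge> 1 \<Longrightarrow> alt_cycle 1 k = 1"
  by (simp add: alt_cycle_def)

text \<open>For \<open>n = 1\<close> and \<open>n = 2\<close> the sum is empty, so the small cases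
  are instances too.\<close>

lemma v_eq:
  assumes "n \<ge> 1" "k \<in> {1..2 ^ (n - 1)}"
  shows "int (v n k) = 2 ^ ((n - 1) choose 2) * (int k - 1)
    + (\<Sum>j = 1..n - 2. 2 ^ (j choose 2) * (int (alt_cycle (2 ^ j) k) - 1))"
proof -
  let ?f = "\<lambda>j. 2 ^ (j choose 2) * (int (alt_cycle (2 ^ j) k) - 1)"
  obtain xs where xs: "x_vec n k = 1 # xs" "length xs = n - 1" "set xs \<subseteq> {0, 1}" "code xs = k - 1"
    using x_vec_eq_Cons[OF assms] .
  have k: "k \<ge> 1" "k - 1 < 2 ^ (n - 1)"
    using assms(2) by auto
  have "int (v n k) = 2 ^ ((n - 1) choose 2) * (int k - 1) + int (code (agreement_vector xs))"
    using xs k map_agree_one[OF xs(3)]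
    by (simp add: v_def agreement_vector_Cons code_append length_agreement_vector of_nat_diff)
  also have "int (code (agreement_vector xs)) = sum ?f {..<n - 1}"
    using code_agreement_vector[OF xs(3) k(1)] xs k by simp
  also have "\<dots> = sum ?f {1..n - 2}"
  proof (rule sum.mono_neutral_right)
    show "\<forall>j \<in> {..<n - 1} - {1..n - 2}. ?f j = 0"
    proof
      fix j assume "j \<in> {..<n - 1} - {1..n - 2}"
      then have "j = 0" by auto
      then show "?f j = 0"
        using alt_cycle_one[OF k(1)] by simp
    qed
  qed (use assms(1) in auto)
  finally show ?thesis .
qed

theorem theorem1:
  shows "v 1 1 = 0
    \<and> (v 2 1 = 0 \<and> v 2 2 = 1)
    \<and> (\<forall>n \<ge> 3. \<forall>k \<in> {1..2 ^ (n - 1)}.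
         int (v n k) = 2 ^ ((n - 1) choose 2) * (int k - 1)
           + (\<Sum>j = 1..n - 2. 2 ^ (j choose 2) * (int (alt_cycle (2 ^ j) k) - 1)))"
proof (intro conjI)
  show "v 1 1 = 0" "v 2 1 = 0" "v 2 2 = 1"
    using v_eq[of 1 1] v_eq[of 2 1] v_eq[of 2 2] by simp_all
qed (use v_eq in auto)

end
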